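(* Consider the PD-based naive decomposition, i.e. the family of linear operators $\{\mathcal{H}^*_{J,\mathrm{PD}}:V_D\to V_J\}_{J\subseteq D}$ defined recursively by $$\mathcal{H}^*_{\emptyset,\mathrm{PD}}:=\mathbb{E},\qquad \mathcal{H}^*_{J,\mathrm{PD}}:=(I-\mathbb{E})\circ\Big(\mathbb{E}_{\mathbf{X}_{\setminus J}}-\sum_{J'\subsetneq J}\mathcal{H}^*_{J',\mathrm{PD}}\Big)\quad(\emptyset\neq J\subseteq D).$$ This family always satisfies (P1) Unbiasedness, (P2) Relevance and (P3) Lean Decomposability, but the method is not an interaction decomposition: there exist $d$ and a joint distribution of $(X_1,\dots,X_d)$ for which $\{\mathcal{H}^*_{J,\mathrm{PD}}\}_{J\subseteq D}$ is not an interaction decomposition.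
   Context: Setting. Let $d\ge 1$, $D=\{1,\dots,d\}$, and let $\mathbf{X}_D=(X_1,\dots,X_d)$ be a random vector of real feature variables (possibly dependent), each $X_j$ having compactly supported distribution. Let $\mathcal{X}_j\subset\mathbb{R}$ be the nonempty compact set of values that the variable $x_j$ can take, with $X_j\in\mathcal{X}_j$. $V_D$ is the real vector space of bounded measurable functions $g$ on $\prod_{j\in D}\mathcal{X}_j$; for $J\subseteq D$, $V_J\subseteq V_D$ is the subspace of functions depending only on the variables $\mathbf{x}_J=(x_j)_{j\in J}$, and $V_\emptyset=\mathbb{R}$ (constants). Thus $V_{J'}\subseteq V_J$ if $J'\subseteq J$, and any operators $V_D\to V_J$ and $V_D\to V_{J'}$ can be composed (written $\circ$). Put $\setminus J:=D\setminus J$. Operators. $I$ is the identity of $V_D$; $\mathbb{E}:V_D\to\mathbb{R}$, $\mathbb{E}(g)=\mathbb{E}[g(\mathbf{X}_D)]$; $\mathbb{E}_{\mathbf{X}_{\setminus J}}:V_D\to V_J$, $\mathbb{E}_{\mathbf{X}_{\setminus J}}(g)(\mathbf{x}_J)=\mathbb{E}[g(\mathbf{x}_J,\mathbf{X}_{\setminus J})]$ (expectation over the marginal law of $\mathbf{X}_{\setminus J}$, with $\mathbf{x}_J$ fixed). Notation $\frac{\partial g}{\partial\mathbf{x}_J}=0$. With $g|_{\mathbf{x}_J=\mathbf{c}}$ denoting substitution, "$\frac{\partial g}{\partial \mathbf{x}_J}=0$" means by definition (no differentiability assumed) that $\sum_{J'\subseteq J}(-1)^{|J'|}g|_{\mathbf{x}_{J'}=\mathbf{a}_{J'}}=0$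 identically for every $\mathbf{a}_J\in\prod_{j\in J}\mathcal{X}_j$. A family of linear operators $\{\mathcal{H}_J:V_D\to V_J\}_{J\subseteq D}$ is an interaction decomposition (ID) if, for all $J,J'\subseteq D$: (P1) Unbiasedness: $\mathcal{H}_\emptyset=\mathbb{E}$ and $\mathbb{E}\circ\mathcal{H}_J=0$ for $J\neq\emptyset$. (P2) Relevance: for $g\in V_D$, if $\frac{\partial g}{\partial\mathbf{x}_J}=0$, then $\mathcal{H}_J(g)=0$. (P3) Lean Decomposability: if $g\in V_J$, then $\big(\sum_{J'\subseteq J}\mathcal{H}_{J'}\big)(g)=g$. (P4) Idempotence: $\mathcal{H}_J\circ\mathcal{H}_J=\mathcal{H}_J$. (P5) Operational Orthogonality: if $J'\neq J$, then $\mathcal{H}_{J'}\circ\mathcal{H}_J=0$. (P6) Consistency with PD: when all feature variables $X_1,\dots,X_d$ are independent, $\sum_{J'\subseteq J}\mathcal{H}_{J'}=\mathbb{E}_{\mathbf{X}_{\setminus J}}$. *)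

theory Defs
  imports "HOL-Probability.Probability"
begin

text \<open>
  The feature variables are indexed by \<open>D = {1..d}\<close>, points of the product of the value sets
  \<open>\<X> j\<close> are extensional functions on \<open>D\<close>, and a function on that product is represented by an
  element of \<open>extensional box\<close>. Hence HOL equality of such functions is equality on \<open>box\<close>,
  and the vector space operations are the pointwise ones restricted to \<open>box\<close>.
\<close>

type_synonym point = "nat \<Rightarrow> real"
type_synonym point_fun = "point \<Rightarrow> real"

locale feature_vector = prob_space M for M :: "'w measure" +
  fixes d :: nat
    and \<X> :: "nat \<Rightarrow> real set"
    and X :: "nat \<Rightarrow> 'w \<Rightarrow> real"
  assumes d_pos: "1 \<le> d"
    and compact_values: "\<And>j. j \<in> {1..d} \<Longrightarrow> compact (\<X> j)"
    and nonempty_values: "\<And>j. j \<in> {1..d} \<Longrightarrow> \<X> j \<noteq> {}"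
    and random_variable_feature: "\<And>j. j \<in> {1..d} \<Longrightarrow> random_variable borel (X j)"
    and feature_in_values: "\<And>j \<omega>. j \<in> {1..d} \<Longrightarrow> \<omega> \<in> space M \<Longrightarrow> X j \<omega> \<in> \<X> j"
begin

definition D :: "nat set" where
  "D = {1..d}"

definition box :: "point set" where
  "box = (\<Pi>\<^sub>E j\<in>D. \<X> j)"

definition VD :: "point_fun set" where
  "VD = {g \<in> extensional box.
           g \<in> borel_measurable (\<Pi>\<^sub>M j\<in>D. restrict_space borel (\<X> j)) \<and> bounded (g ` box)}"

definition V :: "nat set \<Rightarrow> point_fun set" where
  "V J = {g \<in> VD. \<forall>x\<in>box. \<forall>y\<in>box. (\<forall>j\<in>J. x j = y j) \<longrightarrow> g x = g y}"

text \<open>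
  \<open>replace_coords J a x\<close> is \<open>x\<close> with the coordinates in \<open>J\<close> replaced by those of \<open>a\<close>.
\<close>

definition replace_coords :: "nat set \<Rightarrow> point \<Rightarrow> point \<Rightarrow> point" where
  "replace_coords J a x = merge J (D - J) (a, x)"

text \<open>The real number \<open>E[g(X)]\<close> is regarded as a constant function, that is, as an element of
  \<open>V {}\<close>.\<close>

definition E :: "point_fun \<Rightarrow> point_fun" where
  "E g = (\<lambda>x\<in>box. expectation (\<lambda>\<omega>. g (\<lambda>j\<in>D. X j \<omega>)))"

text \<open>The partial dependence operator: the coordinates in \<open>J\<close> are kept and the others are
  averaged out under their joint marginal law.\<close>

definition PD :: "nat set \<Rightarrow> point_fun \<Rightarrow> point_fun" where
  "PD J g = (\<lambda>x\<in>box. expectation (\<lambda>\<omega>. g (replace_coords J x (\<lambda>j. X j \<omega>))))"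

text \<open>The condition written as vanishing of the partial derivative with respect to the variables
  in \<open>J\<close>; no differentiability is involved.\<close>

definition deriv_zero :: "nat set \<Rightarrow> point_fun \<Rightarrow> bool" where
  "deriv_zero J g \<longleftrightarrow>
     (\<forall>a \<in> (\<Pi>\<^sub>E j\<in>J. \<X> j). \<forall>x\<in>box. (\<Sum>J'\<in>Pow J. (-1) ^ card J' * g (replace_coords J' a x)) = 0)"

definition linear_family :: "(nat set \<Rightarrow> point_fun \<Rightarrow> point_fun) \<Rightarrow> bool" where
  "linear_family H \<longleftrightarrow>
     (\<forall>J\<subseteq>D. (\<forall>g\<in>VD. H J g \<in> V J) \<and>
       (\<forall>g\<in>VD. \<forall>h\<in>VD. \<forall>a b.
          H J (\<lambda>x\<in>box. a * g x + b * h x) = (\<lambda>x\<in>box. a * H J g x + b * H J h x)))"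

definition unbiased :: "(nat set \<Rightarrow> point_fun \<Rightarrow> point_fun) \<Rightarrow> bool" where
  "unbiased H \<longleftrightarrow>
     (\<forall>g\<in>VD. H {} g = E g) \<and>
     (\<forall>J\<subseteq>D. J \<noteq> {} \<longrightarrow> (\<forall>g\<in>VD. E (H J g) = (\<lambda>x\<in>box. 0)))"

definition relevance :: "(nat set \<Rightarrow> point_fun \<Rightarrow> point_fun) \<Rightarrow> bool" where
  "relevance H \<longleftrightarrow> (\<forall>J\<subseteq>D. \<forall>g\<in>VD. deriv_zero J g \<longrightarrow> H J g = (\<lambda>x\<in>box. 0))"

definition lean_decomposability :: "(nat set \<Rightarrow> point_fun \<Rightarrow> point_fun) \<Rightarrow> bool" where
  "lean_decomposability H \<longleftrightarrow>
     (\<forall>J\<subseteq>D. \<forall>g\<in>V J. (\<lambda>x\<in>box. \<Sum>J'\<in>Pow J. H J' g x) = g)"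

definition idempotence :: "(nat set \<Rightarrow> point_fun \<Rightarrow> point_fun) \<Rightarrow> bool" where
  "idempotence H \<longleftrightarrow> (\<forall>J\<subseteq>D. \<forall>g\<in>VD. H J (H J g) = H J g)"

definition operational_orthogonality :: "(nat set \<Rightarrow> point_fun \<Rightarrow> point_fun) \<Rightarrow> bool" where
  "operational_orthogonality H \<longleftrightarrow>
     (\<forall>J\<subseteq>D. \<forall>J'\<subseteq>D. J' \<noteq> J \<longrightarrow> (\<forall>g\<in>VD. H J' (H J g) = (\<lambda>x\<in>box. 0)))"

definition consistency_with_PD :: "(nat set \<Rightarrow> point_fun \<Rightarrow> point_fun) \<Rightarrow> bool" where
  "consistency_with_PD H \<longleftrightarrow>
     (indep_vars (\<lambda>_. borel) X D \<longrightarrow>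
       (\<forall>J\<subseteq>D. \<forall>g\<in>VD. (\<lambda>x\<in>box. \<Sum>J'\<in>Pow J. H J' g x) = PD J g))"

definition interaction_decomposition :: "(nat set \<Rightarrow> point_fun \<Rightarrow> point_fun) \<Rightarrow> bool" where
  "interaction_decomposition H \<longleftrightarrow>
     linear_family H \<and> unbiased H \<and> relevance H \<and> lean_decomposability H \<and>
     idempotence H \<and> operational_orthogonality H \<and> consistency_with_PD H"

text \<open>The value at infinite \<open>J\<close> is a dummy that makes the recursion terminate; only
  \<open>J \<subseteq> D\<close> matters.\<close>

function naive_PD :: "nat set \<Rightarrow> point_fun \<Rightarrow> point_fun" where
  "naive_PD J =
     (if J = {} then E
      else if finite J then
        (\<lambda>g. let f = (\<lambda>x\<in>box. PD J g x - (\<Sum>J' | J' \<subset> J. naive_PD J' g x))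
             in (\<lambda>x\<in>box. f x - E f x))
      else (\<lambda>g. \<lambda>x\<in>box. 0))"
  by auto
termination
  by (relation finite_psubset) auto

declare naive_PD.simps [simp del]

end

end

theory Submission
  imports Defs
begin

text \<open>
  Since \<open>E \<circ> H J = 0\<close> for \<open>J \<noteq> {}\<close>, the recursion telescopes to
  \<open>(\<Sum>J'\<subseteq>J. H J') = PD J - E \<circ> PD J + E\<close>. Lean decomposability follows because \<open>PD J\<close> fixes
  \<open>V J\<close>. Moebius inversion gives \<open>H J g = (\<Sum>K\<subseteq>J. (-1)^(|J|-|K|) PD K g) + c\<close> with a constant
  \<open>c\<close>; the alternating sum is the expectation of the one in \<open>deriv_zero J g\<close> (base point \<open>X\<close>), so
  under that hypothesis \<open>H J g\<close> is a constant, and it is \<open>0\<close> by unbiasedness.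

  Orthogonality fails because \<open>PD {1} \<circ> PD {1,3}\<close> averages over \<open>X 2\<close> and \<open>X 3\<close> as if they
  were independent, whereas \<open>PD {1}\<close> uses their joint law.
\<close>

context feature_vector
begin

section \<open>Coordinate replacement on the box: values and measurability\<close>

abbreviation PX :: "point measure" where
  "PX \<equiv> \<Pi>\<^sub>M j\<in>D. restrict_space borel (\<X> j)"

lemma space_PX: "space PX = box"
  by (simp add: space_PiM box_def space_restrict_space)

lemma finite_subset_D: "J \<subseteq> D \<Longrightarrow> finite J"
  unfolding D_def by (rule finite_subset) auto

text \<open>The hypothesis keeps the result extensional on \<open>D\<close>: for \<open>J\<close>
  reaching outside \<open>D\<close>, \<open>merge\<close> would retain coordinates of
  \<open>a\<close> there.\<close>

lemma replace_coords_eq: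
  assumes "J \<subseteq> D"
  shows "replace_coords J a y = (\<lambda>j\<in>D. if j \<in> J then a j else y j)"
  using assms by (auto simp: replace_coords_def merge_def fun_eq_iff)

lemma replace_coords_in_box:
  assumes "J \<subseteq> D" "x \<in> box" "\<omega> \<in> space M"
  shows "replace_coords J x (\<lambda>j. X j \<omega>) \<in> box"
  using assms feature_in_values
  by (auto simp: replace_coords_eq box_def D_def)

lemma measurable_feature:
  assumes "j \<in> D"
  shows "X j \<in> M \<rightarrow>\<^sub>M restrict_space borel (\<X> j)"
  using assms feature_in_values random_variable_feature
  by (auto intro!: measurable_restrict_space2 simp: D_def)

text \<open>Joint measurability in the point and the outcome is what makes \<open>PD J g\<close>, an
  integral with parameter, measurable in the point.\<close>

lemma measurable_replace_coords:
  assumes "J \<subseteq> D"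
  shows "(\<lambda>p. replace_coords J (fst p) (\<lambda>j. X j (snd p))) \<in> PX \<Otimes>\<^sub>M M \<rightarrow>\<^sub>M PX"
  unfolding replace_coords_eq[OF assms]
proof (rule measurable_restrict)
  fix j assume j: "j \<in> D"
  show "(\<lambda>p. if j \<in> J then fst p j else X j (snd p))
      \<in> PX \<Otimes>\<^sub>M M \<rightarrow>\<^sub>M restrict_space borel (\<X> j)"
  proof (cases "j \<in> J")
    case True
    then show ?thesis
      using measurable_compose[OF measurable_fst measurable_component_singleton[OF j]] by simp
  next
    case False
    then show ?thesis
      using measurable_compose[OF measurable_snd measurable_feature[OF j]] by simp
  qed
qed

lemma measurable_replace_coords_features:
  assumes "J \<subseteq> D" "x \<in> box"
  shows "(\<lambda>\<omega>. replace_coords J x (\<lambda>j. X j \<omega>)) \<in> M \<rightarrow>\<^sub>M PX"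
proof -
  have "(\<lambda>\<omega>. (x, \<omega>)) \<in> M \<rightarrow>\<^sub>M PX \<Otimes>\<^sub>M M"
    using assms by (intro measurable_Pair1') (simp add: space_PX)
  from measurable_compose[OF this measurable_replace_coords[OF assms(1)]] show ?thesis by simp
qed

section \<open>The function spaces \<open>VD\<close> and \<open>V J\<close>\<close>

lemma VD_boundE:
  assumes "g \<in> VD"
  obtains B where "0 \<le> B" "\<And>x. x \<in> box \<Longrightarrow> \<bar>g x\<bar> \<le> B"
proof -
  from assms obtain B where B: "\<And>x. x \<in> box \<Longrightarrow> \<bar>g x\<bar> \<le> B"
    by (auto simp: VD_def bounded_iff)
  show thesis
    by (rule that[of "max 0 B"]) (auto dest: B)
qed

lemma VD_restrictI:
  assumes "f \<in> borel_measurable PX" "\<And>x. x \<in> box \<Longrightarrow> \<bar>f x\<bar> \<le> B"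
  shows "(\<lambda>x\<in>box. f x) \<in> VD"
proof -
  have "(\<lambda>x\<in>box. f x) \<in> borel_measurable PX"
    using assms(1) by (subst measurable_cong[of _ _ f]) (auto simp: space_PX)
  then show ?thesis
    using assms(2) by (auto simp: VD_def bounded_iff)
qed

lemma VD_measurable: "g \<in> VD \<Longrightarrow> g \<in> borel_measurable PX"
  by (simp add: VD_def)

lemma VD_extensional: "g \<in> VD \<Longrightarrow> (\<lambda>x\<in>box. g x) = g"
  by (auto simp: VD_def extensional_restrict)

lemma V_subset_VD: "g \<in> V J \<Longrightarrow> g \<in> VD"
  by (simp add: V_def)

lemma VI:
  assumes "g \<in> VD"
    and "\<And>x y. x \<in> box \<Longrightarrow> y \<in> box \<Longrightarrow> \<forall>j\<in>J. x j = y j \<Longrightarrow> g x = g y"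
  shows "g \<in> V J"
  using assms unfolding V_def by blast

lemma V_eqD:
  "g \<in> V J \<Longrightarrow> x \<in> box \<Longrightarrow> y \<in> box \<Longrightarrow> \<forall>j\<in>J. x j = y j \<Longrightarrow> g x = g y"
  unfolding V_def by blast

lemma V_mono: "J' \<subseteq> J \<Longrightarrow> g \<in> V J' \<Longrightarrow> g \<in> V J"
  unfolding V_def by blast

text \<open>An arbitrary finite index set lets one statement serve both for binary combinations,
  indexed by \<open>bool\<close>, and for the sums over proper subsets in the recursion.\<close>

lemma V_sum:
  assumes "finite S" "\<And>i. i \<in> S \<Longrightarrow> f i \<in> V J"
  shows "(\<lambda>x\<in>box. \<Sum>i\<in>S. c i * f i x) \<in> V J"
proof -
  have "\<exists>B. \<forall>x\<in>box. \<bar>f i x\<bar> \<le> B" if "i \<in> S" for i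
    using VD_boundE[OF V_subset_VD[OF assms(2)[OF that]]] by metis
  then obtain B where B: "\<And>i x. i \<in> S \<Longrightarrow> x \<in> box \<Longrightarrow> \<bar>f i x\<bar> \<le> B i"
    by metis
  show ?thesis
  proof (rule VI[OF VD_restrictI])
    show "(\<lambda>x. \<Sum>i\<in>S. c i * f i x) \<in> borel_measurable PX"
      using assms(2)
      by (intro borel_measurable_sum borel_measurable_times borel_measurable_const
          VD_measurable V_subset_VD)
    show "\<bar>\<Sum>i\<in>S. c i * f i x\<bar> \<le> (\<Sum>i\<in>S. \<bar>c i\<bar> * B i)" if "x \<in> box" for x
      using that B
      by (intro order.trans[OF sum_abs] sum_mono) (auto simp: abs_mult intro!: mult_left_mono)
  next
    fix x y assume xy: "x \<in> box" "y \<in> box" "\<forall>j\<in>J. x j = y j"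
    have "f i x = f i y" if "i \<in> S" for i
      using V_eqD[OF assms(2)[OF that] xy] .
    with xy(1,2) show "(\<lambda>x\<in>box. \<Sum>i\<in>S. c i * f i x) x = (\<lambda>x\<in>box. \<Sum>i\<in>S. c i * f i x) y"
      by simp
  qed
qed

lemma V_lincomb:
  assumes "g \<in> V J" "h \<in> V J"
  shows "(\<lambda>x\<in>box. a * g x + b * h x) \<in> V J"
  using V_sum[of UNIV "\<lambda>i. if i then g else h" J "\<lambda>i. if i then a else b"] assms
  by (simp add: UNIV_bool add.commute)

text \<open>Points of \<open>box\<close> are extensional on \<open>D\<close>, so agreement on
  \<open>D\<close> is equality. The closure lemmas for \<open>V J\<close> thereby cover
  \<open>VD\<close> as well.\<close>

lemma VD_eq_V: "VD = V D"
proof (intro equalityI subsetI)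
  fix g assume g: "g \<in> VD"
  have "x = y" if "x \<in> box" "y \<in> box" "\<forall>j\<in>D. x j = y j" for x y
    using that unfolding box_def by (intro PiE_ext[of x D \<X>]) auto
  then show "g \<in> V D"
    by (intro VI[OF g] arg_cong[of _ _ g])
qed (rule V_subset_VD)

lemma const_in_V: "(\<lambda>x\<in>box. c) \<in> V J"
  by (rule VI[OF VD_restrictI[of _ "\<bar>c\<bar>"]]) simp_all

section \<open>The partial dependence operator and the expectation\<close>

lemma integrable_replace_coords:
  assumes "g \<in> VD" "J \<subseteq> D" "x \<in> box"
  shows "integrable M (\<lambda>\<omega>. g (replace_coords J x (\<lambda>j. X j \<omega>)))"
proof -
  obtain B where "\<And>x. x \<in> box \<Longrightarrow> \<bar>g x\<bar> \<le> B"
    using VD_boundE[OF assms(1)] by metis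
  then show ?thesis
    using assms replace_coords_in_box[OF assms(2,3)]
    by (intro integrable_const_bound[of _ B]
        measurable_compose[OF measurable_replace_coords_features VD_measurable]) auto
qed

text \<open>Measurability comes from integrating a jointly measurable function, and a bound on
  \<open>g\<close> survives averaging under a probability measure. The point \<open>x\<close> enters
  the integrand only through its coordinates in \<open>J\<close>.\<close>

lemma PD_in_V:
  assumes "g \<in> VD" "J \<subseteq> D"
  shows "PD J g \<in> V J"
proof -
  obtain B where B: "\<And>x. x \<in> box \<Longrightarrow> \<bar>g x\<bar> \<le> B"
    using VD_boundE[OF assms(1)] by metis
  have "PD J g \<in> VD"
    unfolding PD_def
  proof (rule VD_restrictI)
    show "(\<lambda>x. expectation (\<lambda>\<omega>. g (replace_coords J x (\<lambda>j. X j \<omega>)))) \<in> borel_measurable PX"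
      using measurable_compose[OF measurable_replace_coords VD_measurable] assms
      by (intro borel_measurable_lebesgue_integral) (simp add: split_beta')
    fix x assume x: "x \<in> box"
    have int: "integrable M (\<lambda>\<omega>. g (replace_coords J x (\<lambda>j. X j \<omega>)))"
      using assms x by (rule integrable_replace_coords)
    have "\<bar>expectation (\<lambda>\<omega>. g (replace_coords J x (\<lambda>j. X j \<omega>)))\<bar>
        \<le> expectation (\<lambda>\<omega>. \<bar>g (replace_coords J x (\<lambda>j. X j \<omega>))\<bar>)"
      using integral_norm_bound[of M "\<lambda>\<omega>. g (replace_coords J x (\<lambda>j. X j \<omega>))"] by simp
    also have "\<dots> \<le> expectation (\<lambda>\<omega>. B)"
      using int B replace_coords_in_box[OF assms(2) x]
      by (intro integral_mono) auto
    finally show "\<bar>expectation (\<lambda>\<omega>. g (replace_coords J x (\<lambda>j. X j \<omega>)))\<bar> \<le> B"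
      by (simp add: prob_space)
  qed
  then show ?thesis
  proof (rule VI)
    fix x y assume xy: "x \<in> box" "y \<in> box" "\<forall>j\<in>J. x j = y j"
    have "replace_coords J x = replace_coords J y"
      unfolding replace_coords_eq[OF assms(2)] using xy(3) by (intro ext) (simp cong: if_cong)
    with xy(1,2) show "PD J g x = PD J g y"
      by (simp add: PD_def)
  qed
qed

lemma PD_sum:
  assumes "finite S" "J \<subseteq> D" "\<And>i. i \<in> S \<Longrightarrow> f i \<in> VD"
  shows "PD J (\<lambda>x\<in>box. \<Sum>i\<in>S. c i * f i x) = (\<lambda>x\<in>box. \<Sum>i\<in>S. c i * PD J (f i) x)"
proof -
  have "expectation (\<lambda>\<omega>. (\<lambda>x\<in>box. \<Sum>i\<in>S. c i * f i x) (replace_coords J x (\<lambda>j. X j \<omega>)))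
      = (\<Sum>i\<in>S. c i * expectation (\<lambda>\<omega>. f i (replace_coords J x (\<lambda>j. X j \<omega>))))"
    if x: "x \<in> box" for x
  proof -
    have "expectation (\<lambda>\<omega>. (\<lambda>x\<in>box. \<Sum>i\<in>S. c i * f i x) (replace_coords J x (\<lambda>j. X j \<omega>)))
        = expectation (\<lambda>\<omega>. \<Sum>i\<in>S. c i * f i (replace_coords J x (\<lambda>j. X j \<omega>)))"
      using replace_coords_in_box[OF assms(2) x] by (intro Bochner_Integration.integral_cong) auto
    also have "\<dots> = (\<Sum>i\<in>S. c i * expectation (\<lambda>\<omega>. f i (replace_coords J x (\<lambda>j. X j \<omega>))))"
      using x assms
      by (subst Bochner_Integration.integral_sum) (auto intro!: integrable_mult_right integrable_replace_coords)
    finally show ?thesis .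
  qed
  then show ?thesis
    unfolding PD_def by (auto simp: fun_eq_iff)
qed

lemma PD_lincomb:
  assumes "J \<subseteq> D" "g \<in> VD" "h \<in> VD"
  shows "PD J (\<lambda>x\<in>box. a * g x + b * h x) = (\<lambda>x\<in>box. a * PD J g x + b * PD J h x)"
  using PD_sum[of UNIV J "\<lambda>i. if i then g else h" "\<lambda>i. if i then a else b"] assms
  by (simp add: UNIV_bool add.commute)

text \<open>Only coordinates outside \<open>J'\<close> are averaged out, and \<open>g\<close>
  ignores these, so the integrand is the constant \<open>g x\<close>.\<close>

lemma PD_of_V:
  assumes "g \<in> V J'" "J' \<subseteq> J" "J \<subseteq> D"
  shows "PD J g = g"
proof -
  have "expectation (\<lambda>\<omega>. g (replace_coords J x (\<lambda>j. X j \<omega>))) = g x" if x: "x \<in> box" for x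
  proof -
    have "g (replace_coords J x (\<lambda>j. X j \<omega>)) = g x" if "\<omega> \<in> space M" for \<omega>
    proof -
      have "\<forall>j\<in>J'. replace_coords J x (\<lambda>j. X j \<omega>) j = x j"
        using assms by (auto simp: replace_coords_eq)
      then show ?thesis
        by (rule V_eqD[OF assms(1) replace_coords_in_box[OF assms(3) x that] x])
    qed
    then have "expectation (\<lambda>\<omega>. g (replace_coords J x (\<lambda>j. X j \<omega>))) = expectation (\<lambda>\<omega>. g x)"
      by (intro Bochner_Integration.integral_cong) auto
    then show ?thesis by (simp add: prob_space)
  qed
  then have "PD J g = (\<lambda>x\<in>box. g x)"
    unfolding PD_def by (auto simp: fun_eq_iff)
  then show ?thesis
    using VD_extensional[OF V_subset_VD[OF assms(1)]] by simp
qed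

text \<open>All facts on \<open>E\<close> (range, fixed points, linearity) are instances of those on
  \<open>PD\<close>.\<close>

lemma E_eq_PD: "E = PD {}"
proof -
  have "replace_coords {} x y = (\<lambda>j\<in>D. y j)" for x y
    by (simp add: replace_coords_eq)
  then show ?thesis by (intro ext) (simp only: E_def PD_def)
qed

lemma E_in_V: "g \<in> VD \<Longrightarrow> E g \<in> V {}"
  unfolding E_eq_PD by (rule PD_in_V) auto

lemma E_of_V_empty: "g \<in> V {} \<Longrightarrow> E g = g"
  unfolding E_eq_PD by (rule PD_of_V) auto

lemma E_lincomb:
  "g \<in> VD \<Longrightarrow> h \<in> VD \<Longrightarrow> E (\<lambda>x\<in>box. a * g x + b * h x) = (\<lambda>x\<in>box. a * E g x + b * E h x)"
  unfolding E_eq_PD by (rule PD_lincomb) auto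

section \<open>The naive decomposition: recursion, telescoping and closed form\<close>

lemma naive_PD_empty: "naive_PD {} = E"
  by (subst naive_PD.simps) simp

lemma naive_PD_nonempty:
  assumes "J \<noteq> {}" "J \<subseteq> D"
    and "f = (\<lambda>x\<in>box. PD J g x - (\<Sum>J' | J' \<subset> J. naive_PD J' g x))"
  shows "naive_PD J g = (\<lambda>x\<in>box. f x - E f x)"
  using assms finite_subset_D by (subst naive_PD.simps) (simp add: Let_def)

text \<open>Membership of the smaller terms is a hypothesis, so that the lemma can be applied inside
  the induction proving that membership as well as after it.\<close>

lemma naive_PD_defect_in_V:
  assumes "J \<subseteq> D" "g \<in> VD" "\<And>J'. J' \<subset> J \<Longrightarrow> naive_PD J' g \<in> V J"
  shows "(\<lambda>x\<in>box. PD J g x - (\<Sum>J' | J' \<subset> J. naive_PD J' g x)) \<in> V J"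
proof -
  have fin: "finite {J'. J' \<subset> J}"
    using finite_subset_D[OF assms(1)] by (auto intro: finite_subset[of _ "Pow J"])
  have "(\<lambda>x\<in>box. 1 * PD J g x + (-1) * (\<lambda>x\<in>box. \<Sum>J' | J' \<subset> J. 1 * naive_PD J' g x) x) \<in> V J"
    using assms fin by (intro V_lincomb PD_in_V V_sum) auto
  then show ?thesis
    by (simp cong: restrict_cong)
qed

text \<open>Strong induction along the recursion: the terms for \<open>J' \<subset> J\<close> lie in
  \<open>V J'\<close>, hence in \<open>V J\<close>, and subtracting a mean only subtracts a
  constant.\<close>

lemma naive_PD_in_V:
  assumes "J \<subseteq> D" "g \<in> VD"
  shows "naive_PD J g \<in> V J"
  using finite_subset_D[OF assms(1)] assms(1)
proof (induction J rule: finite_psubset_induct)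
  case (psubset J)
  show ?case
  proof (cases "J = {}")
    case True
    then show ?thesis using assms(2) by (simp add: naive_PD_empty E_in_V)
  next
    case False
    define f where "f = (\<lambda>x\<in>box. PD J g x - (\<Sum>J' | J' \<subset> J. naive_PD J' g x))"
    have f: "f \<in> V J"
      unfolding f_def using psubset.IH psubset.prems assms(2)
      by (intro naive_PD_defect_in_V) (auto intro: V_mono[of _ J])
    have "(\<lambda>x\<in>box. 1 * f x + (-1) * E f x) \<in> V J"
      using f by (intro V_lincomb V_mono[OF _ E_in_V]) (auto dest: V_subset_VD)
    then have "(\<lambda>x\<in>box. f x - E f x) \<in> V J" by simp
    then show ?thesis
      by (simp only: naive_PD_nonempty[OF False psubset.prems f_def])
  qed
qed

lemma naive_PD_in_VD: "J \<subseteq> D \<Longrightarrow> g \<in> VD \<Longrightarrow> naive_PD J g \<in> VD"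
  by (rule V_subset_VD[OF naive_PD_in_V])

text \<open>The outer factor \<open>I - E\<close> of the recursion is annihilated by
  \<open>E\<close>, because \<open>E\<close> fixes constants and so
  \<open>E (E f) = E f\<close>.\<close>

lemma E_naive_PD:
  assumes "J \<subseteq> D" "J \<noteq> {}" "g \<in> VD"
  shows "E (naive_PD J g) = (\<lambda>x\<in>box. 0)"
proof -
  define f where "f = (\<lambda>x\<in>box. PD J g x - (\<Sum>J' | J' \<subset> J. naive_PD J' g x))"
  have f: "f \<in> VD"
    unfolding f_def using assms
    by (intro V_subset_VD[OF naive_PD_defect_in_V] V_mono[OF _ naive_PD_in_V]) auto
  have "E (naive_PD J g) = E (\<lambda>x\<in>box. 1 * f x + (-1) * E f x)"
    using naive_PD_nonempty[OF assms(2,1) f_def] by simp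
  also have "\<dots> = (\<lambda>x\<in>box. 1 * E f x + (-1) * E (E f) x)"
    using f E_in_V[OF f] by (intro E_lincomb) (auto dest: V_subset_VD)
  finally show ?thesis
    using E_of_V_empty[OF E_in_V[OF f]] by (simp cong: restrict_cong)
qed

text \<open>Under \<open>E\<close>, the sum over proper subsets keeps only its term at the empty
  set, namely \<open>E g\<close>. The mean removed in the recursion is therefore
  \<open>E (PD J g) - E g\<close>, and moving the proper-subset sum to the other side gives the
  claim.\<close>

lemma sum_naive_PD:
  assumes "J \<subseteq> D" "g \<in> VD" "x \<in> box"
  shows "(\<Sum>J'\<in>Pow J. naive_PD J' g x) = PD J g x - E (PD J g) x + E g x"
proof (cases "J = {}")
  case True
  have "E (E g) = E g"
    using E_of_V_empty[OF E_in_V[OF assms(2)]] .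
  with True show ?thesis
    by (simp add: naive_PD_empty E_eq_PD)
next
  case False
  let ?S = "{J'. J' \<subset> J}"
  define f where "f = (\<lambda>x\<in>box. PD J g x - (\<Sum>J'\<in>?S. naive_PD J' g x))"
  have fin: "finite ?S"
    using finite_subset_D[OF assms(1)] by (auto intro: finite_subset[of _ "Pow J"])
  define F where "F = (\<lambda>x\<in>box. \<Sum>J'\<in>?S. 1 * naive_PD J' g x)"
  have F: "F \<in> VD"
    unfolding F_def VD_eq_V using assms fin VD_eq_V naive_PD_in_VD by (intro V_sum) auto
  have "E F x = (\<Sum>J'\<in>?S. E (naive_PD J' g) x)"
    unfolding E_eq_PD F_def
    using assms fin naive_PD_in_VD by (subst PD_sum) auto
  also have "\<dots> = (\<Sum>J'\<in>{{}}. E (naive_PD J' g) x)"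
  proof (intro sum.mono_neutral_right ballI)
    fix J' assume "J' \<in> ?S - {{}}"
    then have "J' \<subseteq> D" "J' \<noteq> {}" using assms(1) by auto
    then show "E (naive_PD J' g) x = 0" using assms E_naive_PD by simp
  qed (use False fin in auto)
  also have "\<dots> = E g x"
    using E_of_V_empty[OF E_in_V[OF assms(2)]] by (simp add: naive_PD_empty)
  finally have EF: "E F x = E g x" .
  have f_eq: "f = (\<lambda>x\<in>box. 1 * PD J g x + (-1) * F x)"
    by (simp add: f_def F_def cong: restrict_cong)
  have "E f x = 1 * E (PD J g) x + (-1) * E F x"
    unfolding f_eq using assms F PD_in_V by (subst E_lincomb) (auto dest: V_subset_VD)
  then have "naive_PD J g x = PD J g x - (\<Sum>J'\<in>?S. naive_PD J' g x) - (E (PD J g) x - E g x)"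
    using naive_PD_nonempty[OF False assms(1) f_def] EF assms(3) by (simp add: f_def)
  moreover have "(\<Sum>J'\<in>Pow J. naive_PD J' g x) = naive_PD J g x + (\<Sum>J'\<in>?S. naive_PD J' g x)"
  proof -
    have "Pow J = insert J ?S" by auto
    then show ?thesis using fin by simp
  qed
  ultimately show ?thesis by simp
qed

text \<open>Moebius inversion of \<open>sum_naive_PD\<close> on the subset lattice. The formula is
  free of recursion, so linearity can later be read off term by term.\<close>

lemma naive_PD_eq:
  assumes "J \<subseteq> D" "g \<in> VD" "x \<in> box"
  shows "naive_PD J g x =
    (\<Sum>K\<in>Pow J. (-1) ^ (card J - card K) * (PD K g x - E (PD K g) x + E g x))"
proof -
  have "naive_PD J g x =
      (\<Sum>K\<in>Pow J. (-1) ^ (card J - card K) * (\<Sum>K'\<in>Pow K. naive_PD K' g x))"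
    using finite_subset_D[OF assms(1)]
    by (intro inclusion_exclusion_mobius[where f = "\<lambda>K. naive_PD K g x"]) auto
  also have "\<dots> =
      (\<Sum>K\<in>Pow J. (-1) ^ (card J - card K) * (PD K g x - E (PD K g) x + E g x))"
    using assms sum_naive_PD by (intro sum.cong refl) auto
  finally show ?thesis .
qed

text \<open>The terms involving \<open>E\<close> do not vary with \<open>x\<close>. Their total need
  not be computed: unbiasedness determines it in the proof of relevance, and it cancels from
  differences of values in the counterexample.\<close>

lemma naive_PD_eq_up_to_const:
  assumes "J \<subseteq> D" "g \<in> VD"
  obtains c where "\<And>x. x \<in> box \<Longrightarrow>
    naive_PD J g x = (\<Sum>K\<in>Pow J. (-1) ^ (card J - card K) * PD K g x) + c"
proof
  \<comment> \<open>The real number behind the constant function \<open>E h\<close>; with it the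
    witness can be written without \<open>x\<close>.\<close>
  let ?e = "\<lambda>h. expectation (\<lambda>\<omega>. h (\<lambda>j\<in>D. X j \<omega>)) :: real"
  fix x assume x: "x \<in> box"
  then have "E h x = ?e h" for h
    by (simp add: E_def)
  then show "naive_PD J g x = (\<Sum>K\<in>Pow J. (-1) ^ (card J - card K) * PD K g x)
      + (\<Sum>K\<in>Pow J. (-1) ^ (card J - card K) * (?e g - ?e (PD K g)))"
    by (simp add: naive_PD_eq[OF assms x] sum.distrib[symmetric] algebra_simps)
qed

section \<open>Linearity, unbiasedness, lean decomposability and relevance\<close>

lemma linear_family_naive_PD: "linear_family naive_PD"
  unfolding linear_family_def
proof (intro allI impI conjI ballI)
  fix J g h and a b :: real
  assume J: "J \<subseteq> D" and g: "g \<in> VD" and h: "h \<in> VD"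
  define k where "k = (\<lambda>x\<in>box. a * g x + b * h x)"
  have k: "k \<in> VD"
    using V_lincomb[of g D h a b] g h by (simp add: VD_eq_V k_def)
  have PDk: "PD K k = (\<lambda>x\<in>box. a * PD K g x + b * PD K h x)" if "K \<subseteq> D" for K
    using PD_lincomb[OF that g h] by (simp add: k_def)
  have Ek: "E k = (\<lambda>x\<in>box. a * E g x + b * E h x)"
    using PDk[of "{}"] by (simp add: E_eq_PD)
  have EPDk: "E (PD K k) = (\<lambda>x\<in>box. a * E (PD K g) x + b * E (PD K h) x)" if "K \<subseteq> D" for K
    unfolding PDk[OF that] using PD_in_V[OF g that] PD_in_V[OF h that]
    by (intro E_lincomb) (auto dest: V_subset_VD)
  have eq: "PD K k x - E (PD K k) x + E k x
      = a * (PD K g x - E (PD K g) x + E g x) + b * (PD K h x - E (PD K h) x + E h x)"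
    if "K \<subseteq> D" "x \<in> box" for K x
    unfolding EPDk[OF that(1)] unfolding PDk[OF that(1)] Ek
    using that by (simp add: algebra_simps)
  have "naive_PD J k x = a * naive_PD J g x + b * naive_PD J h x" if x: "x \<in> box" for x
    using J x unfolding naive_PD_eq[OF J g x] naive_PD_eq[OF J h x] naive_PD_eq[OF J k x]
    unfolding sum_distrib_left sum.distrib[symmetric]
    by (intro sum.cong refl) (simp add: eq subset_trans[OF _ J] distrib_left mult.left_commute)
  then show "naive_PD J (\<lambda>x\<in>box. a * g x + b * h x)
      = (\<lambda>x\<in>box. a * naive_PD J g x + b * naive_PD J h x)"
    using VD_extensional[OF naive_PD_in_VD[OF J k]] unfolding k_def[symmetric]
    by (metis (no_types, lifting) restrict_ext)
qed (rule naive_PD_in_V)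

lemma unbiased_naive_PD: "unbiased naive_PD"
  by (simp add: unbiased_def naive_PD_empty E_naive_PD)

lemma lean_decomposability_naive_PD: "lean_decomposability naive_PD"
  unfolding lean_decomposability_def
proof (intro allI impI ballI)
  fix J g assume J: "J \<subseteq> D" and g: "g \<in> V J"
  have "PD J g = g"
    using g J by (intro PD_of_V) auto
  then have "(\<lambda>x\<in>box. \<Sum>J'\<in>Pow J. naive_PD J' g x) = (\<lambda>x\<in>box. g x)"
    using sum_naive_PD[OF J V_subset_VD[OF g]] by (simp cong: restrict_cong)
  then show "(\<lambda>x\<in>box. \<Sum>J'\<in>Pow J. naive_PD J' g x) = g"
    using VD_extensional[OF V_subset_VD[OF g]] by simp
qed

lemma alternating_sum_PD_eq_0:
  assumes J: "J \<subseteq> D" and g: "g \<in> VD" and "deriv_zero J g" and x: "x \<in> box"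
  shows "(\<Sum>K\<in>Pow J. (-1) ^ (card J - card K) * PD K g x) = 0"
proof -
  define \<xi> where "\<xi> \<omega> = (\<lambda>j\<in>D. X j \<omega>)" for \<omega>
  have \<xi>: "\<xi> \<omega> \<in> box" if "\<omega> \<in> space M" for \<omega>
    using feature_in_values that by (auto simp: \<xi>_def box_def D_def)
  \<comment> \<open>The argument of \<open>PD\<close> supplies the substituted values in
    \<open>deriv_zero\<close>, while the random point \<open>\<xi> \<omega>\<close> plays the base
    point.\<close>
  have a: "restrict x J \<in> (\<Pi>\<^sub>E j\<in>J. \<X> j)"
    using x J by (auto simp: box_def)
  \<comment> \<open>As \<open>K \<subseteq> J\<close>, the difference of cardinals is not truncated
    and the sign splits into a product.\<close>
  have "(\<Sum>K\<in>Pow J. (-1) ^ (card J - card K) * PD K g x)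
      = (-1) ^ card J * (\<Sum>K\<in>Pow J. (-1) ^ card K * PD K g x)"
    unfolding sum_distrib_left using finite_subset_D[OF J]
    by (intro sum.cong refl)
      (simp add: card_mono power_add mult.assoc[symmetric]
        flip: neg_one_power_add_eq_neg_one_power_diff)
  also have "(\<Sum>K\<in>Pow J. (-1) ^ card K * PD K g x)
      = expectation (\<lambda>\<omega>. \<Sum>K\<in>Pow J. (-1) ^ card K * g (replace_coords K x (\<lambda>j. X j \<omega>)))"
    using J g x
    by (subst Bochner_Integration.integral_sum)
      (auto simp: PD_def intro!: integrable_mult_right integrable_replace_coords)
  also have "\<dots> = expectation (\<lambda>\<omega>. 0)"
  proof (intro Bochner_Integration.integral_cong refl)
    fix \<omega> assume \<omega>: "\<omega> \<in> space M"
    have "replace_coords K x (\<lambda>j. X j \<omega>) = replace_coords K (restrict x J) (\<xi> \<omega>)"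
      if "K \<in> Pow J" for K
    proof -
      have "K \<subseteq> D" using that J by auto
      then show ?thesis
        using that by (auto simp: replace_coords_eq \<xi>_def fun_eq_iff)
    qed
    then show "(\<Sum>K\<in>Pow J. (-1) ^ card K * g (replace_coords K x (\<lambda>j. X j \<omega>))) = 0"
      using assms(3) a \<xi>[OF \<omega>] by (simp add: deriv_zero_def)
  qed
  finally show ?thesis by simp
qed

lemma relevance_naive_PD: "relevance naive_PD"
  unfolding relevance_def
proof (intro allI impI ballI)
  fix J g assume J: "J \<subseteq> D" and g: "g \<in> VD" and dz: "deriv_zero J g"
  show "naive_PD J g = (\<lambda>x\<in>box. 0)"
  proof (cases "J = {}")
    \<comment> \<open>Unbiasedness says nothing at the empty set. There \<open>deriv_zero\<close>
      has the single summand \<open>g x\<close>, which forces \<open>g\<close> itself to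
      vanish.\<close>
    case True
    have "g x = 0" if "x \<in> box" for x
    proof -
      have "replace_coords {} a x = x" for a
        using that by (simp add: replace_coords_eq box_def extensional_restrict PiE_def)
      then show ?thesis
        using dz that by (auto simp: deriv_zero_def True)
    qed
    then have "(\<lambda>x\<in>box. g x) = (\<lambda>x\<in>box. 0)"
      by (auto simp: fun_eq_iff)
    then have "g = (\<lambda>x\<in>box. 0)"
      using VD_extensional[OF g] by simp
    then show ?thesis
      using E_of_V_empty[OF const_in_V[of 0]] by (simp add: naive_PD_empty True)
  next
    case False
    obtain c where c: "\<And>x. x \<in> box \<Longrightarrow>
        naive_PD J g x = (\<Sum>K\<in>Pow J. (-1) ^ (card J - card K) * PD K g x) + c"
      using naive_PD_eq_up_to_const[OF J g] by metis
    then have "naive_PD J g x = c" if "x \<in> box" for x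
      using alternating_sum_PD_eq_0[OF J g dz that] that by simp
    then have "naive_PD J g = (\<lambda>x\<in>box. c)"
      using VD_extensional[OF naive_PD_in_VD[OF J g]] by (metis (no_types, lifting) restrict_ext)
    \<comment> \<open>A constant equals its own mean, and that mean is zero.\<close>
    then show ?thesis
      using E_of_V_empty[OF const_in_V[of c]] E_naive_PD[OF J False g] by simp
  qed
qed

end

section \<open>A dependent distribution violating orthogonality\<close>

lemma naive_PD_not_interaction_decomposition:
  "\<exists>(M :: (nat \<Rightarrow> real) measure) d \<X> X. feature_vector M d \<X> X \<and>
      \<not> feature_vector.interaction_decomposition M d \<X> X (feature_vector.naive_PD M d \<X> X)"
proof -
  \<comment> \<open>\<open>X 1 = X 2 = X 3\<close> is a fair coin; \<open>H {1} \<circ> H {1,3}\<close> does not kill the product \<open>x 1 * x 2 * x 3\<close>.\<close>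
  define M :: "(nat \<Rightarrow> real) measure" where "M = measure_pmf (pmf_of_set {\<lambda>_. 0, \<lambda>_. 1})"
  define \<X> :: "nat \<Rightarrow> real set" where "\<X> = (\<lambda>_. {0, 1})"
  \<comment> \<open>The space of \<open>M\<close> is the whole type, so the features must take
    values in {0, 1} even off the support; an indicator ensures this.\<close>
  define X :: "nat \<Rightarrow> (nat \<Rightarrow> real) \<Rightarrow> real" where "X = (\<lambda>j \<omega>. of_bool (\<omega> = (\<lambda>_. 1)))"
  have M: "prob_space M"
    unfolding M_def by (rule prob_space_measure_pmf)
  then interpret feature_vector M 3 \<X> X
    by (rule feature_vector.intro, unfold_locales) (auto simp: \<X>_def X_def M_def)
  have ne: "(\<lambda>_. 0) \<noteq> (\<lambda>_::nat. 1::real)"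
    by (metis zero_neq_one)
  have expect: "expectation f = (f (\<lambda>_. 0) + f (\<lambda>_. 1)) / 2" for f :: "_ \<Rightarrow> real"
    unfolding M_def using ne by (subst integral_pmf_of_set) auto
  have D: "D = {1, 2, 3}"
    by (auto simp: D_def)
  have box_eq: "box = (\<Pi>\<^sub>E j\<in>D. {0, 1})"
    unfolding box_def by (rule PiE_cong) (simp add: \<X>_def)
  have X_values: "X j (\<lambda>_. 0) = 0" "X j (\<lambda>_. 1) = 1" for j
    using ne by (simp_all add: X_def)
  define pt :: "real \<Rightarrow> real \<Rightarrow> real \<Rightarrow> point" where
    "pt a b c = (\<lambda>j\<in>D. if j = 1 then a else if j = 2 then b else c)" for a b c
  have pt_box: "pt a b c \<in> box" if "a \<in> {0,1}" "b \<in> {0,1}" "c \<in> {0,1}" for a b c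
    using that by (auto simp: pt_def box_eq)
  \<comment> \<open>The averaged coordinates are all 0 or all 1 together, each with probability
    1/2.\<close>
  have PD_pt: "PD J f (pt a b c) =
      (f (pt (if 1 \<in> J then a else 0) (if 2 \<in> J then b else 0) (if 3 \<in> J then c else 0))
     + f (pt (if 1 \<in> J then a else 1) (if 2 \<in> J then b else 1) (if 3 \<in> J then c else 1))) / 2"
    if "J \<subseteq> D" "a \<in> {0,1}" "b \<in> {0,1}" "c \<in> {0,1}" for J f a b c
  proof -
    have "replace_coords J (pt a b c) (\<lambda>j. r) =
        pt (if 1 \<in> J then a else r) (if 2 \<in> J then b else r) (if 3 \<in> J then c else r)" for r
      using that(1) by (auto simp: replace_coords_eq pt_def D fun_eq_iff)
    then show ?thesis
      using pt_box[OF that(2-4)] by (simp add: PD_def expect X_values)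
  qed
  define g where "g = (\<lambda>x\<in>box. x 1 * x 2 * x 3)"
  have g: "g \<in> VD"
    unfolding g_def
  proof (rule VD_restrictI)
    have coord: "(\<lambda>x. x j) \<in> borel_measurable PX" if "j \<in> D" for j
      using measurable_component_singleton[OF that, of "\<lambda>j. restrict_space borel (\<X> j)"]
      by (simp add: measurable_restrict_space2_iff)
    show "(\<lambda>x. x 1 * x 2 * x 3) \<in> borel_measurable PX"
      by (intro borel_measurable_times coord) (simp_all add: D)
    show "\<bar>x 1 * x 2 * x 3\<bar> \<le> 1" if "x \<in> box" for x
    proof -
      have "x 1 \<in> {0,1}" "x 2 \<in> {0,1}" "x 3 \<in> {0,1}"
        using that by (auto simp: box_eq D)
      then show ?thesis by auto
    qed
  qed
  have g_pt: "g (pt a b c) = a * b * c" if "a \<in> {0,1}" "b \<in> {0,1}" "c \<in> {0,1}" for a b c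
    using pt_box[OF that] by (simp add: g_def pt_def D)
  define h where "h = naive_PD {1, 3} g"
  have h: "h \<in> VD"
    unfolding h_def using g by (intro naive_PD_in_VD) (auto simp: D)
  have Pow: "Pow {1, 3} = {{}, {1}, {3}, {1, 3 :: nat}}" "Pow {1} = {{}, {1 :: nat}}"
    by (auto simp: Pow_insert)
  obtain k where "\<And>x. x \<in> box \<Longrightarrow>
      h x = (\<Sum>K\<in>Pow {1, 3}. (-1) ^ (card {1, 3 :: nat} - card K) * PD K g x) + k"
    unfolding h_def using naive_PD_eq_up_to_const[OF _ g, of "{1, 3}"] by (auto simp: D)
  then have k: "h x = PD {1, 3} g x - PD {1} g x - PD {3} g x + PD {} g x + k"
    if "x \<in> box" for x
    using that unfolding Pow by simp
  \<comment> \<open>The four \<open>PD\<close> terms are \<open>a * c / 2\<close>,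
    \<open>a / 2\<close>, \<open>c / 2\<close> and \<open>1 / 2\<close>, so \<open>h\<close> is
    \<open>(1 - a) * (1 - c) / 2 + k\<close>.\<close>
  have h_pt: "h (pt a b c) = a * c / 2 - a / 2 - c / 2 + 1 / 2 + k"
    if "a \<in> {0,1}" "b \<in> {0,1}" "c \<in> {0,1}" for a b c
    unfolding k[OF pt_box[OF that]] using that by (auto simp: D PD_pt g_pt)
  obtain l where "\<And>x. x \<in> box \<Longrightarrow>
      naive_PD {1} h x = (\<Sum>K\<in>Pow {1}. (-1) ^ (card {1 :: nat} - card K) * PD K h x) + l"
    using naive_PD_eq_up_to_const[OF _ h, of "{1}"] by (auto simp: D)
  then have l: "naive_PD {1} h x = PD {1} h x - PD {} h x + l" if "x \<in> box" for x
    using that unfolding Pow by simp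
  \<comment> \<open>Comparing two points removes \<open>k\<close>, \<open>l\<close> and the constant
    \<open>PD {} h\<close>. What remains is \<open>PD {1} h\<close>, equal to
    \<open>(1 - a) / 4 + k\<close> at first coordinate \<open>a\<close>, so the values differ by
    1/4.\<close>
  have "naive_PD {1} h (pt 1 1 1) \<noteq> naive_PD {1} h (pt 0 0 0)"
    using pt_box by (subst (1 2) l) (simp_all add: D PD_pt h_pt)
  then have "naive_PD {1} (naive_PD {1, 3} g) \<noteq> (\<lambda>x\<in>box. 0)"
    using pt_box by (auto simp: h_def)
  then have "\<not> operational_orthogonality naive_PD"
    using g unfolding operational_orthogonality_def by (force simp: D)
  then have "\<not> interaction_decomposition naive_PD"
    by (simp add: interaction_decomposition_def)
  then show ?thesis
    using feature_vector_axioms by blast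
qed

theorem proposition6:
  "(\<forall>(M :: 'w measure) d \<X> X. feature_vector M d \<X> X \<longrightarrow>
      feature_vector.linear_family d \<X> (feature_vector.naive_PD M d \<X> X) \<and>
      feature_vector.unbiased M d \<X> X (feature_vector.naive_PD M d \<X> X) \<and>
      feature_vector.relevance d \<X> (feature_vector.naive_PD M d \<X> X) \<and>
      feature_vector.lean_decomposability d \<X> (feature_vector.naive_PD M d \<X> X)) \<and>
   (\<exists>(M :: (nat \<Rightarrow> real) measure) d \<X> X. feature_vector M d \<X> X \<and>
      \<not> feature_vector.interaction_decomposition M d \<X> X (feature_vector.naive_PD M d \<X> X))"
  using feature_vector.linear_family_naive_PD feature_vector.unbiased_naive_PD
    feature_vector.relevance_naive_PD feature_vector.lean_decomposability_naive_PD
    naive_PD_not_interaction_decomposition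
  by blast

end
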